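(* For $n \in \mathbb{N}$ (including $n=0$), the number of antichains of subsets of the set $\{1,2,\ldots,n\}$ is given by $$|\mathcal{A}_n| = \sum_{k=0}^{n} \left\{ {n+1 \atop k+1} \right\} |\mathcal{D}_{k}|,$$ where $\left\{ {m \atop j} \right\}$ denotes the Stirling number of the second kind.
   Context: For a finite set $N$, $\mathcal{A}_N$ denotes the set of antichains in $N$: sets $\alpha \subseteq 2^N$ such that no two distinct members of $\alpha$ are in a subset/superset relationship (both $\{\}$ and $\{\emptyset\}$ are antichains). $\mathcal{A}_n=\mathcal{A}_{\{1,\ldots,n\}}$, $\mathcal{A}_0=\mathcal{A}_\emptyset=\{\{\},\{\emptyset\}\}$. Order: $\alpha \le \beta$ iff for every $A \in \alpha$ there is $B \in \beta$ with $A \subseteq B$. The basic interval of dimension $n$ is $\mathcal{B}_n=\{\alpha\in\mathcal{A}_n : \{\{1\},\ldots,\{n\}\}\le\alpha\}$ (so $\mathcal{B}_0=\mathcal{A}_0$). For an antichain $\pi$ of disjoint sets with union $\cup\pi$, $\mathcal{B}_\pi=\{\alpha\in\mathcal{A}_{\cup\pi} : \pi\le\alpha$ and for all $A\in\alpha$ and $X\in\pi$: $X\subseteq A$ or $X\cap A=\emptyset\}$. For $\alpha\in\mathcal{B}_n$ consider the coarsest partition $\pi$ of $\{1,\ldots,n\}$ (the one with the fewest blocks) such that $\alpha\in\mathcal{B}_\pi$; its blocks are the maximal sets of elements which are never separated by a member of $\alpha$. For $k\le n$, $\mathcal{D}_{n,k}$ is the set of $\alpha\in\mathcal{B}_n$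 for which this partition has exactly $k$ blocks, and $\mathcal{D}_k=\mathcal{D}_{k,k}$. The empty set has exactly one partition, with $0$ blocks, so $\mathcal{D}_0=\{\{\},\{\emptyset\}\}$. *)

theory Defs
  imports "HOL-Library.Disjoint_Sets" "HOL-Combinatorics.Stirling"
begin

definition antichains :: "'a set \<Rightarrow> 'a set set set" where
  "antichains N = {\<alpha>. \<alpha> \<subseteq> Pow N \<and> (\<forall>A\<in>\<alpha>. \<forall>B\<in>\<alpha>. A \<subseteq> B \<longrightarrow> A = B)}"

definition antichain_le :: "'a set set \<Rightarrow> 'a set set \<Rightarrow> bool" where
  "antichain_le \<alpha> \<beta> \<longleftrightarrow> (\<forall>A\<in>\<alpha>. \<exists>B\<in>\<beta>. A \<subseteq> B)"

definition basic_interval :: "nat \<Rightarrow> nat set set set" where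
  "basic_interval n = {\<alpha> \<in> antichains {1..n}. antichain_le ((\<lambda>i. {i}) ` {1..n}) \<alpha>}"

definition block_interval :: "'a set set \<Rightarrow> 'a set set set" where
  "block_interval \<pi> =
    {\<alpha> \<in> antichains (\<Union>\<pi>). antichain_le \<pi> \<alpha> \<and> (\<forall>A\<in>\<alpha>. \<forall>X\<in>\<pi>. X \<subseteq> A \<or> X \<inter> A = {})}"

text \<open>
  ``Coarsest'' is meant in the refinement order: every admissible partition refines \<open>\<pi>\<close>.
  On \<open>basic_interval n\<close> such a partition exists and is unique (\<open>ex1_coarsest_partition\<close>),
  and it is the unique admissible partition with the fewest blocks
  (\<open>coarsest_partition_iff_fewest_blocks\<close>).
\<close>

definition coarsest_partition :: "nat \<Rightarrow> nat set set \<Rightarrow> nat set set \<Rightarrow> bool" where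
  "coarsest_partition n \<alpha> \<pi> \<longleftrightarrow>
    partition_on {1..n} \<pi> \<and> \<alpha> \<in> block_interval \<pi> \<and>
    (\<forall>\<sigma>. partition_on {1..n} \<sigma> \<and> \<alpha> \<in> block_interval \<sigma> \<longrightarrow> refines {1..n} \<sigma> \<pi>)"

definition D_nk :: "nat \<Rightarrow> nat \<Rightarrow> nat set set set" where
  "D_nk n k = {\<alpha> \<in> basic_interval n. \<exists>\<pi>. coarsest_partition n \<alpha> \<pi> \<and> card \<pi> = k}"

definition D :: "nat \<Rightarrow> nat set set set" where
  "D k = D_nk k k"

lemma refines_card:
  assumes "finite S" "refines S \<sigma> \<pi>"
  shows "card \<pi> \<le> card \<sigma>" "card \<pi> = card \<sigma> \<Longrightarrow> \<pi> = \<sigma>"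
proof -
  have ps: "partition_on S \<sigma>" and pp: "partition_on S \<pi>"
    and sub: "\<And>X. X \<in> \<sigma> \<Longrightarrow> \<exists>Y\<in>\<pi>. X \<subseteq> Y"
    using assms(2) by (auto simp: refines_def)
  define f where "f X = (SOME Y. Y \<in> \<pi> \<and> X \<subseteq> Y)" for X
  have f: "f X \<in> \<pi>" "X \<subseteq> f X" if "X \<in> \<sigma>" for X
    using someI_ex[of "\<lambda>Y. Y \<in> \<pi> \<and> X \<subseteq> Y"] sub[OF that] unfolding f_def by auto
  have fin: "finite \<sigma>" using finite_elements[OF assms(1) ps] .
  have un: "Y = \<Union>{X\<in>\<sigma>. f X = Y}" if "Y \<in> \<pi>" for Y
  proof (intro subset_antisym subsetI)
    fix x assume x: "x \<in> Y"
    then have "x \<in> \<Union>\<sigma>" using that ps pp by (auto simp: partition_on_def)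
    then obtain X where X: "X \<in> \<sigma>" "x \<in> X" by blast
    have "f X = Y" using partition_onD2[OF pp] f[OF X(1)] X x that
      by (auto simp: disjoint_def)
    then show "x \<in> \<Union>{X\<in>\<sigma>. f X = Y}" using X by auto
  qed (use f in auto)
  have img: "f ` \<sigma> = \<pi>"
  proof
    show "f ` \<sigma> \<subseteq> \<pi>" using f by auto
    show "\<pi> \<subseteq> f ` \<sigma>"
    proof
      fix Y assume Y: "Y \<in> \<pi>"
      then have "Y \<noteq> {}" using pp by (auto simp: partition_on_def)
      with un[OF Y] obtain X where "X \<in> \<sigma>" "f X = Y" by blast
      then show "Y \<in> f ` \<sigma>" by auto
    qed
  qed
  show "card \<pi> \<le> card \<sigma>" using card_image_le[OF fin, of f] img by simp
  assume "card \<pi> = card \<sigma>"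
  then have inj: "inj_on f \<sigma>" using img fin by (simp add: eq_card_imp_inj_on)
  have "f X = X" if X: "X \<in> \<sigma>" for X
  proof -
    have "{Z\<in>\<sigma>. f Z = f X} = {X}" using inj X by (auto dest: inj_onD)
    then show ?thesis using un[OF f(1)[OF X]] by simp
  qed
  then show "\<pi> = \<sigma>" using img by auto
qed

lemma ex1_coarsest_partition:
  assumes "\<alpha> \<in> basic_interval n"
  shows "\<exists>!\<pi>. coarsest_partition n \<alpha> \<pi>"
proof -
  define C where "C x = {y \<in> {1..n}. \<forall>A\<in>\<alpha>. x \<in> A \<longleftrightarrow> y \<in> A}" for x
  define \<pi> where "\<pi> = C ` {1..n}"
  have part: "partition_on {1..n} \<pi>"
    unfolding partition_on_def disjoint_def \<pi>_def C_def by blast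
  have cov: "\<exists>A\<in>\<alpha>. x \<in> A" if "x \<in> {1..n}" for x
    using assms that unfolding basic_interval_def antichain_le_def by auto
  have mem: "\<alpha> \<in> block_interval \<pi>"
  proof -
    have "\<alpha> \<in> antichains (\<Union>\<pi>)"
      using assms part by (simp add: basic_interval_def partition_on_def)
    moreover have "antichain_le \<pi> \<alpha>"
      unfolding antichain_le_def \<pi>_def
    proof safe
      fix x assume "x \<in> {1..n}"
      then obtain A where "A \<in> \<alpha>" "x \<in> A" using cov by blast
      then show "\<exists>B\<in>\<alpha>. C x \<subseteq> B" unfolding C_def by blast
    qed
    moreover have "\<forall>A\<in>\<alpha>. \<forall>X\<in>\<pi>. X \<subseteq> A \<or> X \<inter> A = {}"
      unfolding \<pi>_def C_def by blast
    ultimately show ?thesis by (simp add: block_interval_def)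
  qed
  have ref: "refines {1..n} \<sigma> \<pi>"
    if s: "partition_on {1..n} \<sigma>" "\<alpha> \<in> block_interval \<sigma>" for \<sigma>
    unfolding refines_def
  proof (intro conjI ballI s(1) part)
    fix X assume X: "X \<in> \<sigma>"
    then obtain x where x: "x \<in> X" using s(1) unfolding partition_on_def by (metis equals0I)
    have sub: "X \<subseteq> {1..n}" using X s(1) by (auto simp: partition_on_def)
    have sep: "X \<subseteq> A \<or> X \<inter> A = {}" if "A \<in> \<alpha>" for A
      using s(2) X that by (auto simp: block_interval_def)
    have "X \<subseteq> C x"
    proof
      fix y assume y: "y \<in> X"
      have "x \<in> A \<longleftrightarrow> y \<in> A" if "A \<in> \<alpha>" for A
        using sep[OF that] x y by auto
      then show "y \<in> C x" using y sub unfolding C_def by auto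
    qed
    then show "\<exists>Y\<in>\<pi>. X \<subseteq> Y" using x sub unfolding \<pi>_def by blast
  qed
  have c: "coarsest_partition n \<alpha> \<pi>"
    unfolding coarsest_partition_def using part mem ref by blast
  show ?thesis
  proof (rule ex1I[of _ \<pi>], rule c)
    fix \<sigma> assume s: "coarsest_partition n \<alpha> \<sigma>"
    have "refines {1..n} \<sigma> \<pi>" "refines {1..n} \<pi> \<sigma>"
      using c s unfolding coarsest_partition_def by blast+
    then show "\<sigma> = \<pi>"
      using refines_asym by blast
  qed
qed

lemma coarsest_partition_iff_fewest_blocks:
  assumes "\<alpha> \<in> basic_interval n"
  shows "coarsest_partition n \<alpha> \<pi> \<longleftrightarrow>
    is_arg_min card (\<lambda>\<sigma>. partition_on {1..n} \<sigma> \<and> \<alpha> \<in> block_interval \<sigma>) \<pi>"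
proof
  assume c: "coarsest_partition n \<alpha> \<pi>"
  then show "is_arg_min card (\<lambda>\<sigma>. partition_on {1..n} \<sigma> \<and> \<alpha> \<in> block_interval \<sigma>) \<pi>"
    unfolding is_arg_min_def coarsest_partition_def
    using refines_card(1)[of "{1..n}"] by (simp add: not_less) 
next
  assume m: "is_arg_min card (\<lambda>\<sigma>. partition_on {1..n} \<sigma> \<and> \<alpha> \<in> block_interval \<sigma>) \<pi>"
  obtain \<rho> where r: "coarsest_partition n \<alpha> \<rho>" using ex1_coarsest_partition[OF assms] by blast
  have ref: "refines {1..n} \<pi> \<rho>"
    using r m unfolding coarsest_partition_def is_arg_min_def by blast
  have "card \<pi> \<le> card \<rho>"
    using r m unfolding coarsest_partition_def is_arg_min_def by (meson not_less)
  then have "\<rho> = \<pi>" using refines_card[OF _ ref] by simp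
  then show "coarsest_partition n \<alpha> \<pi>" using r by simp
qed

lemma D_0: "D 0 = {{}, {{}}}"
proof -
  have "coarsest_partition 0 \<alpha> {}" if "\<alpha> \<in> basic_interval 0" for \<alpha>
    using that by (auto simp: coarsest_partition_def basic_interval_def block_interval_def
        antichain_le_def partition_on_def refines_def)
  then have "D 0 = basic_interval 0" by (force simp: D_def D_nk_def)
  also have "\<dots> = Pow {{}}"
    by (auto simp: basic_interval_def antichains_def antichain_le_def)
  also have "\<dots> = {{}, {{}}}" by auto
  finally show ?thesis .
qed

end

theory Submission
  imports Defs
begin

text \<open>
  Adjoin a point \<open>0\<close> to \<open>{1..n}\<close> that lies in no member of the antichain \<open>\<alpha>\<close>. Calling two points
  equivalent when no member of \<open>\<alpha>\<close> separates them partitions the \<open>n + 1\<close> points of \<open>{0..n}\<close>; the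
  block of \<open>0\<close> is the complement of \<open>\<Union>\<alpha>\<close>. If there are \<open>k + 1\<close> blocks, then collapsing each block
  to a point turns \<open>\<alpha>\<close> into an antichain on \<open>{0..k}\<close> that separates all points and avoids \<open>0\<close>,
  which is exactly an element of \<open>D k\<close>, and every element of \<open>D k\<close> pulls back uniquely.
\<close>

section \<open>Counting set partitions\<close>

definition partitions :: "'a set \<Rightarrow> nat \<Rightarrow> 'a set set set" where
  "partitions S k = {P. partition_on S P \<and> card P = k}"

lemma finite_partitions: "finite S \<Longrightarrow> finite (partitions S k)"
  unfolding partitions_def using finitely_many_partition_on by (rule finite_subset[rotated]) auto

lemma partitions_zero: "partitions S 0 = (if S = {} then {{}} else {})" if "finite S"
  using that finite_elements[OF that]
  by (auto simp: partitions_def partition_on_def card_eq_0_iff)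

text \<open>Set-level form of the Stirling recurrence: either \<open>a\<close> is a block by itself,
  or deleting \<open>a\<close> from its block leaves a nonempty block \<open>X\<close> of a
  partition of \<open>S\<close>. The pairs \<open>(P, X)\<close> record the choice of the block that
  receives \<open>a\<close>, which produces the factor \<open>Suc k\<close> when they are
  counted.\<close>

lemma partitions_insert:
  assumes fin: "finite S" and a: "a \<notin> S"
  shows "partitions (insert a S) (Suc k) =
    insert {a} ` partitions S k \<union>
    (\<lambda>(P, X). insert (insert a X) (P - {X})) ` (SIGMA P : partitions S (Suc k). P)"
    (is "?L = ?R1 \<union> ?R2")
proof (intro subset_antisym subsetI)
  fix Q assume Q: "Q \<in> ?L"
  then have pQ: "partition_on (insert a S) Q" and cQ: "card Q = Suc k"
    by (auto simp: partitions_def)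
  have finQ: "finite Q" using cQ by (simp add: card_ge_0_finite)
  have "a \<in> \<Union>Q" using pQ by (auto simp: partition_on_def)
  then obtain Y where Y: "Y \<in> Q" "a \<in> Y" by blast
  have dis: "Z \<inter> Y = {}" if "Z \<in> Q" "Z \<noteq> Y" for Z
    using pQ that Y by (auto simp: partition_on_def disjoint_def)
  have un: "\<Union>Q = insert a S" and ne: "{} \<notin> Q" using pQ by (auto simp: partition_on_def)
  have pd: "Z \<inter> W = {}" if "Z \<in> Q" "W \<in> Q" "Z \<noteq> W" for Z W
    using pQ that by (auto simp: partition_on_def disjoint_def)
  show "Q \<in> ?R1 \<union> ?R2"
  proof (cases "Y = {a}")
    case True
    have "\<Union>(Q - {Y}) = S"
    proof
      show "\<Union>(Q - {Y}) \<subseteq> S" using un dis True by blast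
      show "S \<subseteq> \<Union>(Q - {Y})" using un True a by blast
    qed
    then have "partition_on S (Q - {Y})"
      using ne pd by (auto simp: partition_on_def disjoint_def)
    moreover have "card (Q - {Y}) = k" using cQ Y by simp
    moreover have "Q = insert {a} (Q - {Y})" using True Y by blast
    ultimately show ?thesis by (auto simp: partitions_def)
  next
    case False
    define X where "X = Y - {a}"
    define P where "P = insert X (Q - {Y})"
    have Xne: "X \<noteq> {}" using False Y by (auto simp: X_def)
    \<comment> \<open>Since \<open>X\<close> is a nonempty part of \<open>Y\<close>, disjointness
      keeps it from being another block of \<open>Q\<close>. Hence replacing \<open>Y\<close> by
      \<open>X\<close> preserves the number of blocks.\<close>
    have Xn: "X \<notin> Q - {Y}" using dis Xne by (auto simp: X_def)
    have "\<Union>P = S"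
    proof
      have "a \<notin> Z" if "Z \<in> P" for Z
      proof (cases "Z = X")
        case False
        then show ?thesis using that dis[of Z] Y by (auto simp: P_def)
      qed (simp add: X_def)
      moreover have "\<Union>P \<subseteq> \<Union>Q" using Y by (auto simp: P_def X_def)
      ultimately show "\<Union>P \<subseteq> S" using un by auto
      show "S \<subseteq> \<Union>P" using un a unfolding P_def X_def by blast
    qed
    moreover have "disjoint P"
      unfolding disjoint_def P_def X_def using pd Y by blast
    ultimately have "partition_on S P"
      using ne Xne by (auto simp: partition_on_def P_def)
    moreover have "card P = Suc k" using Xn cQ Y finQ by (simp add: P_def)
    ultimately have "(P, X) \<in> (SIGMA P : partitions S (Suc k). P)"
      by (auto simp: partitions_def P_def)
    moreover have "Q = insert (insert a X) (P - {X})"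
      using Xn Y insert_Diff[of a Y] insert_Diff[of Y Q] by (simp add: P_def X_def)
    ultimately show ?thesis by blast
  qed
next
  fix Q assume "Q \<in> ?R1 \<union> ?R2"
  then show "Q \<in> ?L"
  proof
    assume "Q \<in> ?R1"
    then obtain P where P: "partition_on S P" "card P = k" "Q = insert {a} P"
      by (auto simp: partitions_def)
    have "{a} \<notin> P" using P(1) a by (auto simp: partition_on_def)
    then have "card Q = Suc k" using P finite_elements[OF fin P(1)] by simp
    moreover have "partition_on (insert a S) Q"
      using P(1,3) a by (auto simp: partition_on_def disjoint_def)
    ultimately show ?thesis by (simp add: partitions_def)
  next
    assume "Q \<in> ?R2"
    then obtain P X where P: "partition_on S P" "card P = Suc k" "X \<in> P"
      "Q = insert (insert a X) (P - {X})"
      by (auto simp: partitions_def)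
    have "insert a X \<notin> P - {X}" using P(1) a by (auto simp: partition_on_def)
    then have "card Q = Suc k" using P finite_elements[OF fin P(1)] by simp
    moreover have "\<Union>Q = insert a S" using P(1,3,4) by (auto simp: partition_on_def)
    moreover have "{} \<notin> Q" using P(1,4) by (auto simp: partition_on_def)
    moreover have "disjoint Q"
    proof -
      have "\<And>Z W. Z \<in> P \<Longrightarrow> W \<in> P \<Longrightarrow> Z \<noteq> W \<Longrightarrow> Z \<inter> W = {}" "\<And>Z. Z \<in> P \<Longrightarrow> a \<notin> Z"
        using P(1) a by (auto simp: partition_on_def disjoint_def)
      then show ?thesis unfolding P(4) disjoint_def using P(3) by blast
    qed
    ultimately show ?thesis by (simp add: partitions_def partition_on_def)
  qed
qed

text \<open>Induction along \<open>partitions_insert\<close>: both families there are injectively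
  parametrized and they are disjoint, so their sizes add up to the recurrence that defines
  \<open>Stirling\<close>.\<close>

lemma card_partitions:
  assumes "finite S"
  shows "card (partitions S k) = Stirling (card S) k"
  using assms
proof (induction S arbitrary: k rule: finite_induct)
  case empty
  have "partitions {} k = (if k = 0 then {{}} else {} :: 'a set set set)"
    by (auto simp: partitions_def partition_on_empty)
  then show ?case by (cases k) auto
next
  case (insert a S)
  show ?case
  proof (cases k)
    case 0
    then show ?thesis using insert by (simp add: partitions_zero)
  next
    case (Suc l)
    let ?R = "SIGMA P : partitions S (Suc l). P"
    let ?f = "\<lambda>(P, X). insert (insert a X) (P - {X})"
    have notin: "a \<notin> X" if "P \<in> partitions S j" "X \<in> P" for P X j
      using that insert.hyps(2) by (auto simp: partitions_def partition_on_def)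
    have "inj_on (insert {a}) (partitions S l)"
      using notin by (intro inj_onI) (metis insertI1 insert_ident)
    then have c1: "card (insert {a} ` partitions S l) = Stirling (card S) l"
      by (simp add: card_image insert.IH)
    have "inj_on ?f ?R"
    proof (rule inj_onI, clarify)
      fix P X P' X'
      assume P: "P \<in> partitions S (Suc l)" "X \<in> P" and P': "P' \<in> partitions S (Suc l)" "X' \<in> P'"
        and eq: "insert (insert a X) (P - {X}) = insert (insert a X') (P' - {X'})"
      have n: "a \<notin> X" "a \<notin> X'" "\<forall>Z\<in>P. a \<notin> Z" "\<forall>Z\<in>P'. a \<notin> Z"
        using notin P P' by blast+
      \<comment> \<open>The common image has exactly one block containing \<open>a\<close>. That
        block determines \<open>X\<close>, and the remaining blocks determine
        \<open>P - {X}\<close>.\<close>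
      have "insert a X \<in> insert (insert a X') (P' - {X'})" using eq by blast
      moreover have "insert a X \<notin> P'" using n by blast
      ultimately have "insert a X = insert a X'" by blast
      then have X: "X = X'" using n by (simp add: insert_ident)
      have "P - {X} = P' - {X'}" using eq n X by (metis Diff_iff insertI1 insert_ident)
      then show "P = P' \<and> X = X'" using X P P' by blast
    qed
    then have "card (?f ` ?R) = card ?R" by (rule card_image)
    also have "\<dots> = (\<Sum>P\<in>partitions S (Suc l). card P)"
      using finite_partitions[OF insert.hyps(1)] finite_elements[OF insert.hyps(1)]
      by (intro card_SigmaI) (auto simp: partitions_def)
    also have "\<dots> = (\<Sum>P\<in>partitions S (Suc l). Suc l)"
      by (rule sum.cong) (auto simp: partitions_def)
    also have "\<dots> = Suc l * Stirling (card S) (Suc l)" by (simp add: insert.IH)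
    finally have c2: "card (?f ` ?R) = Suc l * Stirling (card S) (Suc l)" .
    \<comment> \<open>The block \<open>{a}\<close> tells the two families apart: in the second one
      \<open>a\<close> always joins a nonempty block.\<close>
    have notin_image: "{a} \<notin> Q" if "Q \<in> ?f ` ?R" for Q
    proof
      assume "{a} \<in> Q"
      with that obtain P X where P: "P \<in> partitions S (Suc l)" "X \<in> P"
        and "{a} \<in> insert (insert a X) (P - {X})" by auto
      then have "X \<subseteq> {a}" using notin by blast
      then have "X = {}" using notin P by blast
      then show False using P by (auto simp: partitions_def partition_on_def)
    qed
    have "insert {a} ` partitions S l \<inter> ?f ` ?R = {}"
    proof (rule equals0I)
      fix Q assume Q: "Q \<in> insert {a} ` partitions S l \<inter> ?f ` ?R"
      then have "{a} \<in> Q" by (elim IntE imageE) simp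
      then show False using notin_image[OF IntD2[OF Q]] by contradiction
    qed
    moreover have "finite (insert {a} ` partitions S l)" "finite (?f ` ?R)"
      using finite_partitions[OF insert.hyps(1)] finite_elements[OF insert.hyps(1)]
      by (auto intro!: finite_imageI finite_SigmaI simp: partitions_def)
    ultimately show ?thesis
      unfolding Suc partitions_insert[OF insert.hyps]
      using insert.hyps by (simp add: card_Un_disjoint c1 c2)
  qed
qed

section \<open>Points not separated by an antichain\<close>

definition same_side :: "'a set set \<Rightarrow> 'a \<Rightarrow> 'a \<Rightarrow> bool" where
  "same_side \<alpha> x y \<longleftrightarrow> (\<forall>A\<in>\<alpha>. x \<in> A \<longleftrightarrow> y \<in> A)"

text \<open>The set \<open>S\<close> may exceed the ground set of \<open>\<alpha>\<close>. With
  \<open>S = {0..n}\<close> and \<open>\<alpha>\<close> on \<open>{1..n}\<close>, all points covered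
  by no member, \<open>0\<close> among them, form a single block.\<close>

definition side_partition :: "'a set \<Rightarrow> 'a set set \<Rightarrow> 'a set set" where
  "side_partition S \<alpha> = (\<lambda>x. {y \<in> S. same_side \<alpha> x y}) ` S"

lemma partition_on_side_partition: "partition_on S (side_partition S \<alpha>)"
  unfolding partition_on_def disjoint_def side_partition_def same_side_def by blast

text \<open>A partition is determined by its equivalence relation. This turns the condition defining
  a fibre into a pointwise one, which can then be expressed through a map constant exactly on the
  blocks.\<close>

lemma side_partition_eq_iff:
  assumes P: "partition_on S P"
  shows "side_partition S \<alpha> = P \<longleftrightarrow>
    (\<forall>x\<in>S. \<forall>y\<in>S. same_side \<alpha> x y \<longleftrightarrow> (\<exists>X\<in>P. x \<in> X \<and> y \<in> X))"
proof
  assume *: "side_partition S \<alpha> = P"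
  show "\<forall>x\<in>S. \<forall>y\<in>S. same_side \<alpha> x y \<longleftrightarrow> (\<exists>X\<in>P. x \<in> X \<and> y \<in> X)"
    unfolding *[symmetric] side_partition_def by (auto simp: same_side_def)
next
  assume *: "\<forall>x\<in>S. \<forall>y\<in>S. same_side \<alpha> x y \<longleftrightarrow> (\<exists>X\<in>P. x \<in> X \<and> y \<in> X)"
  have un: "\<Union>P = S" and ne: "{} \<notin> P" using P by (auto simp: partition_on_def)
  have pd: "Z = W" if "Z \<in> P" "W \<in> P" "x \<in> Z" "x \<in> W" for Z W x
    using P that by (auto simp: partition_on_def disjoint_def)
  have blk: "{y \<in> S. same_side \<alpha> x y} = X" if "X \<in> P" "x \<in> X" for x X
  proof -
    have "x \<in> S" "X \<subseteq> S" using that un by auto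
    then show ?thesis using * that pd by blast
  qed
  show "side_partition S \<alpha> = P"
  proof
    show "side_partition S \<alpha> \<subseteq> P"
      unfolding side_partition_def using blk un by (smt (verit) UnionE image_subsetI)
    show "P \<subseteq> side_partition S \<alpha>"
    proof
      fix X assume X: "X \<in> P"
      then obtain x where "x \<in> X" using ne by (metis ex_in_conv)
      then show "X \<in> side_partition S \<alpha>"
        using blk[OF X] un X unfolding side_partition_def by blast
    qed
  qed
qed

text \<open>Collapsing by \<open>g\<close> and taking preimages are mutually inverse. Preimages
  under a surjection preserve and reflect inclusion, so antichains pull back to antichains;
  conversely, members of an antichain that never separates points with equal \<open>g\<close>-value
  are unions of fibres of \<open>g\<close>. Members live in \<open>T'\<close>, while separation is
  tested on the larger set \<open>T\<close>, which leaves room for the adjoined point.\<close>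

lemma bij_betw_pullback_antichains:
  assumes g: "g ` S = T" and T': "T' \<subseteq> T" and S': "S' = {x \<in> S. g x \<in> T'}"
  shows "bij_betw ((`) (\<lambda>B. {x \<in> S. g x \<in> B}))
    {\<beta> \<in> antichains T'. \<forall>u\<in>T. \<forall>v\<in>T. same_side \<beta> u v \<longrightarrow> u = v}
    {\<alpha> \<in> antichains S'. \<forall>x\<in>S. \<forall>y\<in>S. same_side \<alpha> x y \<longleftrightarrow> g x = g y}"
    (is "bij_betw ?pull ?A ?B")
proof -
  let ?p = "\<lambda>B. {x \<in> S. g x \<in> B}"
  have gp: "g ` ?p B = B" if "B \<subseteq> T'" for B
    using that g T' by auto
  have pull_sub: "?p B \<subseteq> ?p C \<longleftrightarrow> B \<subseteq> C" if "B \<subseteq> T'" "C \<subseteq> T'" for B C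
    using gp[OF that(1)] gp[OF that(2)] image_mono[of "?p B" "?p C" g] by auto
  \<comment> \<open>Saturation: a member containing one point of a fibre of \<open>g\<close>
    contains the whole fibre, because \<open>\<alpha>\<close> does not separate its points.\<close>
  have sat: "?p (g ` A) = A"
    if "\<alpha> \<in> ?B" "A \<in> \<alpha>" for \<alpha> A
  proof -
    have sub: "A \<subseteq> S" using that S' by (auto simp: antichains_def)
    have "x \<in> A" if "x \<in> S" "y \<in> A" "g x = g y" for x y
    proof -
      have "same_side \<alpha> x y" using that sub \<open>\<alpha> \<in> ?B\<close> by blast
      then show ?thesis using that \<open>A \<in> \<alpha>\<close> by (auto simp: same_side_def)
    qed
    then show ?thesis using sub by blast
  qed
  show ?thesis
  proof (rule bij_betw_byWitness[where f' = "(`) ((`) g)"])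
    show "\<forall>\<beta>\<in>?A. (`) g ` ?pull \<beta> = \<beta>"
    proof
      fix \<beta> assume "\<beta> \<in> ?A"
      then have "\<And>B. B \<in> \<beta> \<Longrightarrow> g ` ?p B = B" using gp by (auto simp: antichains_def)
      then show "(`) g ` ?pull \<beta> = \<beta>" by (simp add: image_image)
    qed
    show "\<forall>\<alpha>\<in>?B. ?pull ((`) g ` \<alpha>) = \<alpha>"
    proof
      fix \<alpha> assume "\<alpha> \<in> ?B"
      then have "\<And>A. A \<in> \<alpha> \<Longrightarrow> ?p (g ` A) = A" using sat by blast
      then show "?pull ((`) g ` \<alpha>) = \<alpha>" by (simp add: image_image)
    qed
    show "?pull ` ?A \<subseteq> ?B"
    proof (rule image_subsetI)
      fix \<beta> assume b: "\<beta> \<in> ?A"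
      then have sub: "\<And>B. B \<in> \<beta> \<Longrightarrow> B \<subseteq> T'" by (auto simp: antichains_def)
      have "?pull \<beta> \<in> antichains S'"
        using b pull_sub[OF sub sub] S' sub by (auto simp: antichains_def)
      moreover have "same_side (?pull \<beta>) x y \<longleftrightarrow> same_side \<beta> (g x) (g y)"
        if "x \<in> S" "y \<in> S" for x y using that by (auto simp: same_side_def)
      moreover have "same_side \<beta> (g x) (g y) \<longleftrightarrow> g x = g y" if "x \<in> S" "y \<in> S" for x y
        using that b g by (auto simp: same_side_def)
      ultimately show "?pull \<beta> \<in> ?B" by simp
    qed
    show "(`) ((`) g) ` ?B \<subseteq> ?A"
    proof (rule image_subsetI)
      fix \<alpha> assume a: "\<alpha> \<in> ?B"
      have sep: "same_side \<alpha> x y \<longleftrightarrow> g x = g y" if "x \<in> S" "y \<in> S" for x y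
        using a that by blast
      \<comment> \<open>By saturation the collapsed members separate \<open>g x\<close> from
        \<open>g y\<close> exactly when \<open>\<alpha>\<close> separates \<open>x\<close> from
        \<open>y\<close>.\<close>
      have mem: "g x \<in> g ` A \<longleftrightarrow> x \<in> A" if "A \<in> \<alpha>" "x \<in> S" for A x
        using sat[OF a that(1)] that(2) by blast
      have "A = C" if "A \<in> \<alpha>" "C \<in> \<alpha>" "g ` A \<subseteq> g ` C" for A C
      proof -
        have "?p (g ` A) \<subseteq> ?p (g ` C)" using that by blast
        then have "A \<subseteq> C" using sat[OF a] that by simp
        then show ?thesis using a that by (auto simp: antichains_def)
      qed
      then have "(`) g ` \<alpha> \<in> antichains T'"
        using a S' by (auto simp: antichains_def)
      moreover have "u = v" if "u \<in> T" "v \<in> T" "same_side ((`) g ` \<alpha>) u v" for u v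
      proof -
        obtain x y where xy: "x \<in> S" "y \<in> S" "u = g x" "v = g y"
          using \<open>u \<in> T\<close> \<open>v \<in> T\<close> unfolding g[symmetric] by blast
        then have "same_side \<alpha> x y" using that(3) mem by (auto simp: same_side_def)
        then show ?thesis using sep xy by blast
      qed
      ultimately show "(`) g ` \<alpha> \<in> ?A" by blast
    qed
  qed
qed

text \<open>
  The adjoined point \<open>0\<close> encodes the covering condition of \<open>basic_interval\<close>: a point lying in no
  member of \<open>\<beta>\<close> would not be separated from \<open>0\<close>.
\<close>

lemma D_eq_separating:
  "D k = {\<beta> \<in> antichains {1..k}. \<forall>u\<in>{0..k}. \<forall>v\<in>{0..k}. same_side \<beta> u v \<longrightarrow> u = v}"
proof (intro set_eqI iffI)
  fix \<beta> assume "\<beta> \<in> D k"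
  then obtain \<pi> where b: "\<beta> \<in> basic_interval k" and c: "coarsest_partition k \<beta> \<pi>" and k: "card \<pi> = k"
    by (auto simp: D_def D_nk_def)
  have anti: "\<beta> \<in> antichains {1..k}" using b by (simp add: basic_interval_def)
  have cov: "\<exists>A\<in>\<beta>. x \<in> A" if "x \<in> {1..k}" for x
    using b that unfolding basic_interval_def antichain_le_def by auto
  have n0: "0 \<notin> A" if "A \<in> \<beta>" for A using anti that by (fastforce simp: antichains_def)
  \<comment> \<open>This partition is admissible for \<open>\<beta>\<close>, so it refines the
    coarsest one and has at least \<open>k\<close> blocks. On \<open>k\<close> points that forces
    distinct points into distinct blocks.\<close>
  let ?\<sigma> = "side_partition {1..k} \<beta>"
  have un: "\<Union>?\<sigma> = {1..k}" using partition_on_side_partition by (metis partition_onD1)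
  have "antichain_le ?\<sigma> \<beta>"
    unfolding antichain_le_def
  proof
    fix X assume "X \<in> ?\<sigma>"
    then obtain x where x: "x \<in> {1..k}" "X = {y \<in> {1..k}. same_side \<beta> x y}"
      by (auto simp: side_partition_def)
    obtain A where "A \<in> \<beta>" "x \<in> A" using cov x by blast
    then show "\<exists>B\<in>\<beta>. X \<subseteq> B" using x by (auto simp: same_side_def)
  qed
  moreover have "\<forall>A\<in>\<beta>. \<forall>X\<in>?\<sigma>. X \<subseteq> A \<or> X \<inter> A = {}"
    unfolding side_partition_def same_side_def by blast
  ultimately have "\<beta> \<in> block_interval ?\<sigma>" using anti un by (simp add: block_interval_def)
  then have "refines {1..k} ?\<sigma> \<pi>"
    using c partition_on_side_partition unfolding coarsest_partition_def by blast
  then have "k \<le> card ?\<sigma>" using refines_card(1) k by blast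
  moreover have "card ?\<sigma> \<le> card {1..k}"
    unfolding side_partition_def by (rule card_image_le) simp
  ultimately have "card ?\<sigma> = card {1..k}" by simp
  then have inj: "inj_on (\<lambda>x. {y \<in> {1..k}. same_side \<beta> x y}) {1..k}"
    unfolding side_partition_def by (intro eq_card_imp_inj_on) auto
  have zero: "u = 0" if "u \<in> {0..k}" "same_side \<beta> u 0" for u
  proof (rule ccontr)
    assume "u \<noteq> 0"
    then obtain A where "A \<in> \<beta>" "u \<in> A" using cov[of u] \<open>u \<in> {0..k}\<close> by auto
    then show False using n0 that(2) by (auto simp: same_side_def)
  qed
  have "u = v" if uv: "u \<in> {0..k}" "v \<in> {0..k}" "same_side \<beta> u v" for u v
  proof (cases "u = 0 \<or> v = 0")
    case True
    moreover have "same_side \<beta> v u" using uv(3) by (simp add: same_side_def)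
    ultimately show ?thesis using zero uv by blast
  next
    case False
    then have "u \<in> {1..k}" "v \<in> {1..k}" using uv by auto
    moreover have "{y \<in> {1..k}. same_side \<beta> u y} = {y \<in> {1..k}. same_side \<beta> v y}"
      using uv(3) by (auto simp: same_side_def)
    ultimately show ?thesis using inj by (auto dest: inj_onD)
  qed
  then show "\<beta> \<in> {\<beta> \<in> antichains {1..k}. \<forall>u\<in>{0..k}. \<forall>v\<in>{0..k}. same_side \<beta> u v \<longrightarrow> u = v}"
    using anti by blast
next
  fix \<beta> assume "\<beta> \<in> {\<beta> \<in> antichains {1..k}. \<forall>u\<in>{0..k}. \<forall>v\<in>{0..k}. same_side \<beta> u v \<longrightarrow> u = v}"
  then have anti: "\<beta> \<in> antichains {1..k}"
    and sep: "\<And>u v. u \<in> {0..k} \<Longrightarrow> v \<in> {0..k} \<Longrightarrow> same_side \<beta> u v \<Longrightarrow> u = v" by blast+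
  have n0: "0 \<notin> A" if "A \<in> \<beta>" for A using anti that by (fastforce simp: antichains_def)
  have "\<exists>A\<in>\<beta>. x \<in> A" if "x \<in> {1..k}" for x
    using sep[of x 0] that n0 by (auto simp: same_side_def)
  then have b: "\<beta> \<in> basic_interval k"
    using anti by (auto simp: basic_interval_def antichain_le_def)
  then obtain \<pi> where c: "coarsest_partition k \<beta> \<pi>" using ex1_coarsest_partition by blast
  then have part: "partition_on {1..k} \<pi>" and bi: "\<beta> \<in> block_interval \<pi>"
    by (auto simp: coarsest_partition_def)
  \<comment> \<open>Members of \<open>\<beta>\<close> do not cut a block of an admissible partition,
    so any two of its points are on the same side and therefore equal. The coarsest partition thus
    consists of \<open>k\<close> singletons.\<close>
  have "x = y" if "X \<in> \<pi>" "x \<in> X" "y \<in> X" for X x y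
  proof (rule sep)
    have "X \<subseteq> {1..k}" using that part by (auto simp: partition_on_def)
    then show "x \<in> {0..k}" "y \<in> {0..k}" using that by auto
    have "X \<subseteq> A \<or> X \<inter> A = {}" if "A \<in> \<beta>" for A
      using bi that \<open>X \<in> \<pi>\<close> by (auto simp: block_interval_def)
    then show "same_side \<beta> x y" using that by (auto simp: same_side_def)
  qed
  then have sing: "X = {x}" if "X \<in> \<pi>" "x \<in> X" for X x using that by blast
  have "\<pi> = (\<lambda>x. {x}) ` {1..k}"
  proof (intro subset_antisym subsetI)
    fix X assume X: "X \<in> \<pi>"
    then obtain x where x: "x \<in> X" using part by (metis ex_in_conv partition_onD3)
    then have "x \<in> {1..k}" using X part by (auto simp: partition_on_def)
    then show "X \<in> (\<lambda>x. {x}) ` {1..k}" using sing[OF X x] by blast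
  next
    fix X assume "X \<in> (\<lambda>x. {x}) ` {1..k}"
    then obtain x where x: "X = {x}" "x \<in> \<Union>\<pi>"
      unfolding partition_onD1[OF part, symmetric] by blast
    then show "X \<in> \<pi>" using sing by blast
  qed
  then have "card \<pi> = k" by (simp add: card_image)
  then show "\<beta> \<in> D k" using b c by (auto simp: D_def D_nk_def)
qed

section \<open>Counting antichains by their side partition\<close>

text \<open>The size of a fibre depends on \<open>P\<close> only through its number of blocks:
  numbering the blocks gives a surjection from \<open>{0..n}\<close> onto \<open>{0..k}\<close>, and
  the fibre consists of the pullbacks of the elements of \<open>D k\<close>.\<close>

lemma card_antichains_side_partition:
  fixes n :: nat
  assumes P: "P \<in> partitions {0..n} (Suc k)"
  shows "card {\<alpha> \<in> antichains {1..n}. side_partition {0..n} \<alpha> = P} = card (D k)"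
proof -
  have part: "partition_on {0..n} P" and card: "card P = Suc k"
    using P by (auto simp: partitions_def)
  have fin: "finite P" using card by (simp add: card_ge_0_finite)
  have un: "\<Union>P = {0..n}" and ne: "{} \<notin> P" using part by (auto simp: partition_on_def)
  have pd: "Z = W" if "Z \<in> P" "W \<in> P" "x \<in> Z" "x \<in> W" for Z W x
    using part that by (auto simp: partition_on_def disjoint_def)
  have "0 \<in> \<Union>P" unfolding un by simp
  then obtain X0 where X0: "X0 \<in> P" "0 \<in> X0" by blast
  have "card (P - {X0}) = card {1..k}" using X0 card by simp
  then obtain h where h: "bij_betw h (P - {X0}) {1..k}"
    using fin finite_same_card_bij by (metis finite_Diff finite_atLeastAtMost)
  \<comment> \<open>The block of the adjoined point gets the number \<open>0\<close>, so that the
    collapse sends \<open>0\<close> to \<open>0\<close> and the other blocks fill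
    \<open>{1..k}\<close>.\<close>
  define f where "f = h(X0 := 0)"
  have "bij_betw f (P - {X0}) {1..k}"
    using h by (subst bij_betw_cong[of _ _ h]) (auto simp: f_def)
  then have "bij_betw f (P - {X0} \<union> {X0}) ({1..k} \<union> {f X0})"
    by (rule notIn_Un_bij_betw[rotated 2]) (auto simp: f_def)
  moreover have "{1..k} \<union> {f X0} = {0..k}" "P - {X0} \<union> {X0} = P"
    using X0 by (auto simp: f_def)
  ultimately have f: "bij_betw f P {0..k}" by simp
  define blk where "blk x = (THE X. X \<in> P \<and> x \<in> X)" for x
  have blk: "blk x = X" if "X \<in> P" "x \<in> X" for x X
    unfolding blk_def by (rule the_equality) (use that pd in auto)
  define g where "g x = f (blk x)" for x
  have blk_in: "blk x \<in> P" "x \<in> blk x" if "x \<in> {0..n}" for x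
  proof -
    have "x \<in> \<Union>P" using that un by simp
    then obtain X where "X \<in> P" "x \<in> X" by blast
    then show "blk x \<in> P" "x \<in> blk x" using blk by simp_all
  qed
  have "blk ` {0..n} = P"
  proof
    show "P \<subseteq> blk ` {0..n}"
    proof
      fix X assume X: "X \<in> P"
      then obtain x where x: "x \<in> X" using ne by (metis ex_in_conv)
      then show "X \<in> blk ` {0..n}" using blk[OF X x] X un by blast
    qed
  qed (use blk_in in blast)
  then have img: "g ` {0..n} = {0..k}"
    using f by (metis bij_betw_imp_surj_on g_def image_cong image_image)
  have geq: "g x = g y \<longleftrightarrow> (\<exists>X\<in>P. x \<in> X \<and> y \<in> X)" if "x \<in> {0..n}" "y \<in> {0..n}" for x y
  proof -
    have "g x = g y \<longleftrightarrow> blk x = blk y"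
      using f blk_in that unfolding g_def by (metis bij_betw_inv_into_left)
    also have "\<dots> \<longleftrightarrow> (\<exists>X\<in>P. x \<in> X \<and> y \<in> X)" using blk blk_in that by metis
    finally show ?thesis .
  qed
  have g0: "g 0 = 0" using blk[OF X0] by (simp add: g_def f_def)
  \<comment> \<open>An antichain with side partition \<open>P\<close> avoids the whole block of \<open>0\<close>, so it already lives on \<open>?S\<close>.\<close>
  let ?S = "{x \<in> {0..n}. g x \<in> {1..k}}"
  have "x \<noteq> 0" if "x \<in> ?S" for x using that g0 by (metis atLeastAtMost_iff mem_Collect_eq not_one_le_zero)
  then have sub: "?S \<subseteq> {1..n}" by fastforce
  have "\<alpha> \<in> antichains ?S"
    if a: "\<alpha> \<in> antichains {1..n}" and s: "\<forall>x\<in>{0..n}. \<forall>y\<in>{0..n}. same_side \<alpha> x y \<longleftrightarrow> g x = g y" for \<alpha>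
  proof -
    have "x \<in> ?S" if "A \<in> \<alpha>" "x \<in> A" for A x
    proof -
      have "A \<subseteq> {1..n}" using that(1) a by (auto simp: antichains_def)
      then have x: "x \<in> {0..n}" "0 \<notin> A" using that(2) by auto
      then have "\<not> same_side \<alpha> x 0" using that by (auto simp: same_side_def)
      then have "g x \<noteq> 0" using s x g0 by auto
      moreover have "g x \<in> {0..k}" using img x by blast
      ultimately show ?thesis using x by auto
    qed
    then show ?thesis using a by (auto simp: antichains_def)
  qed
  moreover have "\<alpha> \<in> antichains {1..n}" if "\<alpha> \<in> antichains ?S" for \<alpha>
    using that sub by (auto simp: antichains_def)
  ultimately have fiber: "{\<alpha> \<in> antichains {1..n}. side_partition {0..n} \<alpha> = P} =
    {\<alpha> \<in> antichains ?S. \<forall>x\<in>{0..n}. \<forall>y\<in>{0..n}. same_side \<alpha> x y \<longleftrightarrow> g x = g y}"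
    unfolding side_partition_eq_iff[OF part] using geq by (smt (verit) Collect_cong)
  \<comment> \<open>The pullback bijection is applied with \<open>T = {0..k}\<close> and
    \<open>T' = {1..k}\<close>: by \<open>D_eq_separating\<close> its domain is \<open>D k\<close>,
    and by \<open>fiber\<close> its range is the set being counted.\<close>
  have "{1..k} \<subseteq> {0..k}" by auto
  from bij_betw_pullback_antichains[OF img this refl] show ?thesis
    unfolding D_eq_separating fiber by (rule bij_betw_same_card[symmetric])
qed

theorem theorem6p5:
  fixes n :: nat
  shows "card (antichains {1..n}) = (\<Sum>k=0..n. Stirling (n + 1) (k + 1) * card (D k))"
proof -
  let ?F = "\<lambda>P. {\<alpha> \<in> antichains {1..n}. side_partition {0..n} \<alpha> = P}"
  \<comment> \<open>\<open>?U k\<close> collects the antichains whose side partition has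
    \<open>k\<close> blocks besides the block of \<open>0\<close>; hence both Stirling indices are
    shifted by one.\<close>
  let ?U = "\<lambda>k. \<Union>P\<in>partitions {0..n} (Suc k). ?F P"
  have fin: "finite (antichains {1..n})"
    by (rule finite_subset[of _ "Pow (Pow {1..n})"]) (auto simp: antichains_def)
  have cU: "card (?U k) = Stirling (n + 1) (k + 1) * card (D k)" for k
  proof -
    have "card (?U k) = (\<Sum>P\<in>partitions {0..n} (Suc k). card (?F P))"
      using fin by (intro card_UN_disjoint) (auto simp: finite_partitions)
    also have "\<dots> = (\<Sum>P\<in>partitions {0..n} (Suc k). card (D k))"
      by (rule sum.cong) (simp_all only: card_antichains_side_partition)
    finally show ?thesis by (simp add: card_partitions)
  qed
  have "antichains {1..n} = (\<Union>k\<in>{0..n}. ?U k)"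
  proof (intro subset_antisym subsetI)
    fix \<alpha> :: "nat set set" assume a: "\<alpha> \<in> antichains {1..n}"
    let ?P = "side_partition {0..n} \<alpha>"
    have "card ?P \<le> card {0..n}" unfolding side_partition_def by (rule card_image_le) simp
    \<comment> \<open>The block of \<open>0\<close> is always present, even for
      \<open>n = 0\<close>, so the number of blocks has the form \<open>Suc k\<close>.\<close>
    moreover have "card ?P \<noteq> 0" by (simp add: side_partition_def)
    ultimately obtain k where "k \<le> n" "card ?P = Suc k" by (cases "card ?P") auto
    then show "\<alpha> \<in> (\<Union>k\<in>{0..n}. ?U k)"
      using a partition_on_side_partition[of "{0..n}" \<alpha>] by (auto simp: partitions_def)
  qed auto
  \<comment> \<open>The sets \<open>?U k\<close> are disjoint because an antichain has only one side
    partition, and with it only one block count.\<close>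
  also have "card \<dots> = (\<Sum>k\<in>{0..n}. card (?U k))"
    using fin by (intro card_UN_disjoint) (auto simp: finite_partitions partitions_def intro: finite_subset[OF _ fin])
  finally show ?thesis by (simp only: cU)
qed

end
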